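(* For every $c\in(0,1)\cap\mathbb{Q}$ the following hold (where "$\models_p\chi$" means $\chi$ is true at every world of every epistemic probability model, and a scheme is valid if all its instances are): (1) The scheme $B^c(\varphi\to\psi)\to(B^c\varphi\to B^c\psi)$ is not valid (some instance is not valid). (2) The scheme $B^c\varphi\to\varphi$ is not valid. (3) $\models_p K\varphi\to B^c\varphi$. (4) $\models_p \neg B^c\bot$. (5) $\models_p B^c\top$. (6) $\models_p B^c\varphi\to KB^c\varphi$. (7) $\models_p \neg B^c\varphi\to K\neg B^c\varphi$. (8) $\models_p K(\varphi\to\psi)\to(B^c\varphi\to B^c\psi)$. (9) If $c\in[\tfrac12,1)$, then $\models_p B^c\varphi\to\check B^c\varphi$. (10) $\models_p \check B^{1/2}\varphi\wedge\check K(\neg\varphi\wedge\psi)\to B^{1/2}(\varphi\vee\psi)$. (11) For every positive integer $m$ and formulas $\varphi_1,\dots,\varphi_m,\psi_1,\dots,\psi_m$: $\models_p \big[(\varphi_i\mathbb{I}\psi_i)_{i=1}^m\wedge B^{1/2}\varphi_1\wedge\bigwedge_{i=2}^m\check B^{1/2}\varphi_i\big]\to\bigvee_{i=1}^m B^{1/2}\psi_i$ (for $m=1$ the empty conjunction is $\top$).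
   Context: Fix a set $\mathsf{Prop}$ of propositional letters. An epistemic probability model is $\mathcal{M}=(W,R,V,P)$ where $W$ is a finite nonempty set, $R$ an equivalence relation on $W$, $V:W\to\wp(\mathsf{Prop})$, and $P$ a probability measure on $\wp(W)$ with full support ($P(\{w\})\neq0$ for all $w$). Write $[w]$ for the $R$-class of $w$ and $P_w(X):=P(X\cap[w])/P([w])$. The probability language: formulas $\varphi::=\top\mid p\mid\neg\varphi\mid\varphi\wedge\varphi\mid t\geq0$, terms $t::=q\mid q\cdot P(\varphi)\mid t+t$ ($q\in\mathbb{Q}$), with usual abbreviations ($\bot,\vee,\to,\leftrightarrow$, and $>,\leq,=$ for linear inequalities). Truth: $\mathcal{M},w\models_p p$ iff $p\in V(w)$; Boolean clauses standard; $t\geq0$ true iff $[\![t]\!]_w\geq0$ where $[\![q\cdot P(\varphi)]\!]_w=q\cdot P_w([\![\varphi]\!])$, $[\![q]\!]_w=q$, terms add, and $[\![\varphi]\!]$ is the set of worlds where $\varphi$ holds. Abbreviations: $K\varphi:=(P(\varphi)=1)$, $\check K\varphi:=\neg K\neg\varphi$, $B^c\varphi:=(P(\varphi)>c)$, $\check B^c\varphi:=\neg B^c\neg\varphi$. Segerberg notation: $(\varphi_1,\dots,\varphi_m\mathbb{I}\psi_1,\dots,\psi_m)$, abbreviated $(\varphi_i\mathbb{I}\psi_i)_{i=1}^m$, is the formula $K(F_0\vee\cdots\vee F_m)$, where $F_i$ is the disjunction of all conjunctions $d_1\varphi_1\wedge\cdots\wedge d_m\varphi_m\wedge e_1\psi_1\wedge\cdots\wedge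 e_m\psi_m$ in which exactly $i$ of the $d_k$ are the empty string, at least $i$ of the $e_k$ are the empty string, and all other $d_k,e_k$ are the negation sign $\neg$ (so it says: at every epistemically accessible world, the number of true $\varphi_k$ is at most the number of true $\psi_k$).
   Formalization: Prop is taken to be nonempty, and item (1) is stated for Prop with at least two letters: with a single letter and c ≥ 1/2 the scheme in (1) is valid, and with no letters (1) and (2) both fail. *)

theory Defs
  imports "HOL-Probability.Probability"
begin

text \<open>
  Propositional letters are the elements of a type \<open>'p\<close>. The constructor \<open>Scale q \<phi>\<close> is the term
  \<open>q \<cdot> P(\<phi>)\<close>, and \<open>Nonneg t\<close> is the formula \<open>t \<ge> 0\<close>.
  With a single letter every formula is constant or equivalent to that letter or its negation
  within each class of \<open>R\<close>, and the scheme \<open>B\<^sup>c(\<phi> \<rightarrow> \<psi>) \<rightarrow> (B\<^sup>c\<phi> \<rightarrow> B\<^sup>c\<psi>)\<close> is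
  then valid for \<open>c \<ge> 1/2\<close>; its non-validity therefore requires two distinct letters.
\<close>

datatype 'p fm =
    Top
  | Letter 'p
  | Neg "'p fm"
  | Conj "'p fm" "'p fm"
  | Nonneg "'p tm"
and 'p tm =
    Const rat
  | Scale rat "'p fm"
  | Plus "'p tm" "'p tm"

record ('w, 'p) epm =
  worlds :: "'w set"
  acc :: "('w \<times> 'w) set"
  val :: "'w \<Rightarrow> 'p set"
  pr :: "'w measure"

definition epistemic_probability_model :: "('w, 'p) epm \<Rightarrow> bool" where
  "epistemic_probability_model M \<longleftrightarrow>
     finite (worlds M) \<and> worlds M \<noteq> {} \<and>
     equiv (worlds M) (acc M) \<and>
     prob_space (pr M) \<and> sets (pr M) = Pow (worlds M) \<and>
     (\<forall>w\<in>worlds M. measure (pr M) {w} \<noteq> 0)"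

definition local_prob :: "('w, 'p) epm \<Rightarrow> 'w \<Rightarrow> 'w set \<Rightarrow> real" where
  "local_prob M w X = measure (pr M) (X \<inter> acc M `` {w}) / measure (pr M) (acc M `` {w})"

primrec sat :: "('w, 'p) epm \<Rightarrow> 'w \<Rightarrow> 'p fm \<Rightarrow> bool"
  and tval :: "('w, 'p) epm \<Rightarrow> 'w \<Rightarrow> 'p tm \<Rightarrow> real" where
  "sat M w Top \<longleftrightarrow> True"
| "sat M w (Letter p) \<longleftrightarrow> p \<in> val M w"
| "sat M w (Neg \<phi>) \<longleftrightarrow> \<not> sat M w \<phi>"
| "sat M w (Conj \<phi> \<psi>) \<longleftrightarrow> sat M w \<phi> \<and> sat M w \<psi>"
| "sat M w (Nonneg t) \<longleftrightarrow> tval M w t \<ge> 0"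
| "tval M w (Const q) = of_rat q"
| "tval M w (Scale q \<phi>) = of_rat q * local_prob M w {v \<in> worlds M. sat M v \<phi>}"
| "tval M w (Plus s t) = tval M w s + tval M w t"

text \<open>
  HOL cannot quantify over types inside a definition, so the type of worlds is a parameter of
  validity. As models are finite, every model is isomorphic to one whose worlds are natural
  numbers.
\<close>

definition valid :: "'w itself \<Rightarrow> 'p fm \<Rightarrow> bool" where
  "valid T \<phi> \<longleftrightarrow>
     (\<forall>M :: ('w, 'p) epm. epistemic_probability_model M \<longrightarrow> (\<forall>w\<in>worlds M. sat M w \<phi>))"

definition Bot :: "'p fm" where
  "Bot = Neg Top"

definition Disj :: "'p fm \<Rightarrow> 'p fm \<Rightarrow> 'p fm" where
  "Disj \<phi> \<psi> = Neg (Conj (Neg \<phi>) (Neg \<psi>))"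

definition Imp :: "'p fm \<Rightarrow> 'p fm \<Rightarrow> 'p fm" where
  "Imp \<phi> \<psi> = Disj (Neg \<phi>) \<psi>"

fun Conjs :: "'p fm list \<Rightarrow> 'p fm" where
  "Conjs [] = Top"
| "Conjs [\<phi>] = \<phi>"
| "Conjs (\<phi> # \<psi> # \<theta>s) = Conj \<phi> (Conjs (\<psi> # \<theta>s))"

fun Disjs :: "'p fm list \<Rightarrow> 'p fm" where
  "Disjs [] = Bot"
| "Disjs [\<phi>] = \<phi>"
| "Disjs (\<phi> # \<psi> # \<theta>s) = Disj \<phi> (Disjs (\<psi> # \<theta>s))"

primrec tneg :: "'p tm \<Rightarrow> 'p tm" where
  "tneg (Const q) = Const (- q)"
| "tneg (Scale q \<phi>) = Scale (- q) \<phi>"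
| "tneg (Plus s t) = Plus (tneg s) (tneg t)"

definition Geq :: "'p tm \<Rightarrow> 'p tm \<Rightarrow> 'p fm" where
  "Geq s t = Nonneg (Plus s (tneg t))"

definition Leq :: "'p tm \<Rightarrow> 'p tm \<Rightarrow> 'p fm" where
  "Leq s t = Geq t s"

definition Greater :: "'p tm \<Rightarrow> 'p tm \<Rightarrow> 'p fm" where
  "Greater s t = Neg (Leq s t)"

definition Equal :: "'p tm \<Rightarrow> 'p tm \<Rightarrow> 'p fm" where
  "Equal s t = Conj (Geq s t) (Leq s t)"

definition Pr :: "'p fm \<Rightarrow> 'p tm" where
  "Pr \<phi> = Scale 1 \<phi>"

definition K :: "'p fm \<Rightarrow> 'p fm" where
  "K \<phi> = Equal (Pr \<phi>) (Const 1)"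

definition K_dual :: "'p fm \<Rightarrow> 'p fm" where
  "K_dual \<phi> = Neg (K (Neg \<phi>))"

definition B :: "rat \<Rightarrow> 'p fm \<Rightarrow> 'p fm" where
  "B c \<phi> = Greater (Pr \<phi>) (Const c)"

definition B_dual :: "rat \<Rightarrow> 'p fm \<Rightarrow> 'p fm" where
  "B_dual c \<phi> = Neg (B c (Neg \<phi>))"

definition signed :: "bool \<Rightarrow> 'p fm \<Rightarrow> 'p fm" where
  "signed b \<phi> = (if b then \<phi> else Neg \<phi>)"

text \<open>
  Here \<open>D\<close> (respectively \<open>E\<close>) lists the indices \<open>k\<close> for which the prefix \<open>d\<^sub>k\<close> (respectively
  \<open>e\<^sub>k\<close>) is the empty string; \<open>List.subseqs [1..<Suc m]\<close> enumerates each subset of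
  \<open>{1..m}\<close> exactly once, without repeated elements.
\<close>

definition segerberg_disjunct ::
    "nat \<Rightarrow> (nat \<Rightarrow> 'p fm) \<Rightarrow> (nat \<Rightarrow> 'p fm) \<Rightarrow> nat \<Rightarrow> 'p fm" where
  "segerberg_disjunct m \<phi> \<psi> i =
     Disjs [Conjs (map (\<lambda>k. signed (k \<in> set D) (\<phi> k)) [1..<Suc m] @
                   map (\<lambda>k. signed (k \<in> set E) (\<psi> k)) [1..<Suc m]).
            D \<leftarrow> List.subseqs [1..<Suc m], E \<leftarrow> List.subseqs [1..<Suc m],
            length D = i \<and> i \<le> length E]"

definition segerberg :: "nat \<Rightarrow> (nat \<Rightarrow> 'p fm) \<Rightarrow> (nat \<Rightarrow> 'p fm) \<Rightarrow> 'p fm" where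
  "segerberg m \<phi> \<psi> = K (Disjs (map (segerberg_disjunct m \<phi> \<psi>) [0..<Suc m]))"

end

theory Submission
  imports Defs
begin

text \<open>
  Part (11): summing the local probabilities of the \<open>\<phi>\<^sub>i\<close> weights each accessible world by the number
  of \<open>\<phi>\<^sub>i\<close> true there, so the Segerberg formula yields
  \<open>\<Sum>i. P\<^sub>w(\<phi>\<^sub>i) \<le> \<Sum>i. P\<^sub>w(\<psi>\<^sub>i)\<close>. The premises make the left-hand side exceed \<open>m/2\<close>, hence some
  \<open>P\<^sub>w(\<psi>\<^sub>i)\<close> exceeds \<open>1/2\<close>. For (1) the counter-model has three worlds in one class, with weights
  \<open>c\<close>, \<open>(1 - c)/2\<close>, \<open>(1 - c)/2\<close>.
\<close>

section \<open>Truth conditions of the abbreviated connectives\<close>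

abbreviation ext :: "('w, 'p) epm \<Rightarrow> 'p fm \<Rightarrow> 'w set" where
  "ext M \<phi> \<equiv> {v \<in> worlds M. sat M v \<phi>}"

lemma sat_Bot [simp]: "\<not> sat M w Bot"
  by (simp add: Bot_def)

lemma sat_Disj [simp]: "sat M w (Disj \<phi> \<psi>) \<longleftrightarrow> sat M w \<phi> \<or> sat M w \<psi>"
  by (simp add: Disj_def)

lemma sat_Imp [simp]: "sat M w (Imp \<phi> \<psi>) \<longleftrightarrow> (sat M w \<phi> \<longrightarrow> sat M w \<psi>)"
  by (auto simp: Imp_def)

lemma sat_Conjs [simp]: "sat M w (Conjs \<phi>s) \<longleftrightarrow> (\<forall>\<phi>\<in>set \<phi>s. sat M w \<phi>)"
  by (induction \<phi>s rule: Conjs.induct) auto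

lemma sat_Disjs [simp]: "sat M w (Disjs \<phi>s) \<longleftrightarrow> (\<exists>\<phi>\<in>set \<phi>s. sat M w \<phi>)"
  by (induction \<phi>s rule: Disjs.induct) auto

lemma sat_signed [simp]: "sat M w (signed b \<phi>) \<longleftrightarrow> (sat M w \<phi> \<longleftrightarrow> b)"
  by (simp add: signed_def)

lemma sat_B [simp]: "sat M w (B c \<phi>) \<longleftrightarrow> local_prob M w (ext M \<phi>) > of_rat c"
  by (simp add: B_def Greater_def Leq_def Geq_def Pr_def of_rat_minus not_le)

lemma sat_K_local_prob: "sat M w (K \<phi>) \<longleftrightarrow> local_prob M w (ext M \<phi>) = 1"
  by (auto simp: K_def Equal_def Leq_def Geq_def Pr_def of_rat_minus)

text \<open>A true conjunction inside the disjunct settles every \<open>\<phi> k\<close> and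
  \<open>\<psi> k\<close> at \<open>v\<close>, so \<open>D\<close> and \<open>E\<close> are exactly
  the index sets being counted.\<close>

lemma sat_segerberg_disjunct:
  assumes "sat M v (segerberg_disjunct m \<phi> \<psi> i)"
  shows "card {k \<in> {1..m}. sat M v (\<phi> k)} \<le> card {k \<in> {1..m}. sat M v (\<psi> k)}"
proof -
  from assms obtain D E where DE: "D \<in> set (List.subseqs [1..<Suc m])" "E \<in> set (List.subseqs [1..<Suc m])"
      "length D \<le> length E"
    and \<phi>: "\<And>k. k \<in> {1..m} \<Longrightarrow> sat M v (\<phi> k) \<longleftrightarrow> k \<in> set D"
    and \<psi>: "\<And>k. k \<in> {1..m} \<Longrightarrow> sat M v (\<psi> k) \<longleftrightarrow> k \<in> set E"
    by (auto simp: segerberg_disjunct_def ball_Un simp del: upt_Suc)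
  \<comment> \<open>The disjunct compares list lengths; these are cardinalities because a sublist of
    a list without repetitions has no repetitions.\<close>
  have "card (set D) = length D" "card (set E) = length E"
    using DE subseqs_distinctD[of _ "[1..<Suc m]"] by (auto intro!: distinct_card simp del: upt_Suc)
  moreover have "set D \<subseteq> {1..m}" "set E \<subseteq> {1..m}"
    using DE subseqs_powset[of "[1..<Suc m]"]
    by (simp_all only: set_upt atLeastLessThanSuc_atLeastAtMost) blast+
  then have "{k \<in> {1..m}. sat M v (\<phi> k)} = set D" "{k \<in> {1..m}. sat M v (\<psi> k)} = set E"
    using \<phi> \<psi> by blast+
  ultimately show ?thesis using DE by simp
qed

section \<open>Local probability in an arbitrary model\<close>

locale epistemic_model =
  fixes M :: "('w, 'p) epm"
  assumes model: "epistemic_probability_model M"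
begin

lemma equiv_acc: "equiv (worlds M) (acc M)"
  using model by (simp add: epistemic_probability_model_def)

lemma acc_subset: "acc M `` {w} \<subseteq> worlds M"
  using equiv_acc by (auto simp: equiv_def refl_on_def)

lemma finite_acc [simp]: "finite (acc M `` {w})"
  using finite_subset[OF acc_subset] model by (simp add: epistemic_probability_model_def)

lemma self_acc: "w \<in> worlds M \<Longrightarrow> w \<in> acc M `` {w}"
  using equiv_acc by (rule equiv_class_self)

lemma acc_eq: "v \<in> acc M `` {w} \<Longrightarrow> acc M `` {v} = acc M `` {w}"
  using equiv_acc by (metis Image_singleton_iff equiv_class_eq)

lemma measure_singleton_pos: "v \<in> worlds M \<Longrightarrow> measure (pr M) {v} > 0"
  using model by (metis epistemic_probability_model_def measure_nonneg order_le_less)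

lemma measure_eq_sum:
  assumes "X \<subseteq> worlds M" shows "measure (pr M) X = (\<Sum>v\<in>X. measure (pr M) {v})"
proof -
  interpret prob_space "pr M" using model by (simp add: epistemic_probability_model_def)
  have "finite X" using assms model by (auto simp: epistemic_probability_model_def intro: finite_subset)
  then show ?thesis using assms model
    by (intro finite_measure_eq_sum_singleton) (auto simp: epistemic_probability_model_def)
qed

text \<open>The class contains \<open>w\<close> by reflexivity, and \<open>w\<close> has positive
  mass by full support; so the denominator of \<open>local_prob\<close> is nonzero at every
  world.\<close>

lemma measure_acc_pos: "w \<in> worlds M \<Longrightarrow> measure (pr M) (acc M `` {w}) > 0"
  using acc_subset[of w] self_acc[of w] measure_singleton_pos
  by (subst measure_eq_sum) (blast intro!: sum_pos finite_acc)+

text \<open>With indicators, the range of summation does not depend on \<open>X\<close>, so events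
  can be compared world by world.\<close>

lemma local_prob_eq_sum:
  "local_prob M w X =
     (\<Sum>v\<in>acc M `` {w}. of_bool (v \<in> X) * measure (pr M) {v}) / measure (pr M) (acc M `` {w})"
proof -
  have "measure (pr M) (X \<inter> acc M `` {w}) = (\<Sum>v\<in>X \<inter> acc M `` {w}. measure (pr M) {v})"
    using acc_subset by (intro measure_eq_sum) blast
  also have "\<dots> = (\<Sum>v\<in>acc M `` {w}. of_bool (v \<in> X) * measure (pr M) {v})"
    by (intro sum.mono_neutral_cong_left) auto
  finally show ?thesis by (simp add: local_prob_def)
qed

lemma local_prob_acc: "v \<in> acc M `` {w} \<Longrightarrow> local_prob M v X = local_prob M w X"
  by (simp only: local_prob_def acc_eq)

lemma local_prob_sum_mono:
  assumes "\<And>v. v \<in> acc M `` {w} \<Longrightarrow> card {i \<in> I. v \<in> X i} \<le> card {i \<in> I. v \<in> Y i}" "finite I"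
  shows "(\<Sum>i\<in>I. local_prob M w (X i)) \<le> (\<Sum>i\<in>I. local_prob M w (Y i))"
proof -
  \<comment> \<open>Double counting: exchanging the two sums collects, at each world, the number of
    events containing it. A generic family \<open>Z\<close> serves both \<open>X\<close> and
    \<open>Y\<close>.\<close>
  have sum: "(\<Sum>i\<in>I. local_prob M w (Z i)) =
      (\<Sum>v\<in>acc M `` {w}. card {i \<in> I. v \<in> Z i} * measure (pr M) {v}) / measure (pr M) (acc M `` {w})"
    for Z
  proof -
    have "(\<Sum>i\<in>I. local_prob M w (Z i)) =
      (\<Sum>i\<in>I. \<Sum>v\<in>acc M `` {w}. of_bool (v \<in> Z i) * measure (pr M) {v}) / measure (pr M) (acc M `` {w})"
      by (simp add: local_prob_eq_sum sum_divide_distrib)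
    also have "\<dots> = (\<Sum>v\<in>acc M `` {w}. \<Sum>i\<in>I. of_bool (v \<in> Z i) * measure (pr M) {v}) / measure (pr M) (acc M `` {w})"
      by (subst sum.swap) simp
    also have "(\<lambda>v. \<Sum>i\<in>I. of_bool (v \<in> Z i) * measure (pr M) {v}) =
        (\<lambda>v. card {i \<in> I. v \<in> Z i} * measure (pr M) {v})"
      using \<open>finite I\<close> by (simp flip: sum_distrib_right add: Int_def)
    finally show ?thesis .
  qed
  show ?thesis unfolding sum using assms
    by (intro divide_right_mono sum_mono mult_right_mono) auto
qed

lemma local_prob_mono:
  assumes "\<And>v. v \<in> acc M `` {w} \<Longrightarrow> v \<in> X \<Longrightarrow> v \<in> Y"
  shows "local_prob M w X \<le> local_prob M w Y"
  unfolding local_prob_eq_sum using assms by (intro divide_right_mono sum_mono) auto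

text \<open>By full support the term at \<open>u\<close> grows strictly, while no other term
  decreases.\<close>

lemma local_prob_less:
  assumes "w \<in> worlds M" "\<And>v. v \<in> acc M `` {w} \<Longrightarrow> v \<in> X \<Longrightarrow> v \<in> Y"
    and "u \<in> acc M `` {w}" "u \<in> Y" "u \<notin> X"
  shows "local_prob M w X < local_prob M w Y"
  unfolding local_prob_eq_sum
proof (intro divide_strict_right_mono sum_strict_mono_ex1 bexI ballI)
  show "of_bool (u \<in> X) * measure (pr M) {u} < of_bool (u \<in> Y) * measure (pr M) {u}"
    using assms acc_subset measure_singleton_pos by auto
qed (use assms measure_acc_pos in auto)

lemma local_prob_worlds: "w \<in> worlds M \<Longrightarrow> local_prob M w (worlds M) = 1"
  using measure_acc_pos[of w] acc_subset[of w] by (simp add: local_prob_def Int_absorb1)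

text \<open>Full support leaves no null worlds, so probability 1 means truth throughout the class.
  This turns \<open>K\<close>, defined by a probability, into the usual modality of
  \<open>acc M\<close>.\<close>

lemma local_prob_eq_1_iff:
  assumes "w \<in> worlds M"
  shows "local_prob M w X = 1 \<longleftrightarrow> acc M `` {w} \<subseteq> X"
proof
  assume "local_prob M w X = 1"
  \<comment> \<open>A missing world \<open>u\<close> would put \<open>X\<close> strictly below an
    event of probability at most 1.\<close>
  moreover have "local_prob M w X < local_prob M w (X \<union> worlds M)"
    if "u \<in> acc M `` {w}" "u \<notin> X" for u
    using that assms acc_subset by (intro local_prob_less[of _ _ _ u]) auto
  moreover have "local_prob M w (X \<union> worlds M) \<le> 1"
    using acc_subset by (subst local_prob_worlds[OF assms, symmetric]) (intro local_prob_mono, blast)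
  ultimately show "acc M `` {w} \<subseteq> X" by fastforce
next
  assume "acc M `` {w} \<subseteq> X"
  then show "local_prob M w X = 1"
    using measure_acc_pos[OF assms] by (simp add: local_prob_def Int_absorb1)
qed

text \<open>At a point outside \<open>worlds M\<close> the class is empty and
  \<open>local_prob\<close> is 0/0 = 0, so \<open>K \<phi>\<close> fails there although the
  right-hand side is vacuously true.\<close>

lemma sat_K [simp]:
  assumes "w \<in> worlds M"
  shows "sat M w (K \<phi>) \<longleftrightarrow> (\<forall>v\<in>acc M `` {w}. sat M v \<phi>)"
  using assms acc_subset[of w] by (auto simp: sat_K_local_prob local_prob_eq_1_iff)

lemma local_prob_Neg:
  assumes "w \<in> worlds M"
  shows "local_prob M w (ext M (Neg \<phi>)) = 1 - local_prob M w (ext M \<phi>)"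
proof -
  have "local_prob M w (ext M (Neg \<phi>)) + local_prob M w (ext M \<phi>) = local_prob M w (worlds M)"
    unfolding local_prob_eq_sum add_divide_distrib[symmetric] sum.distrib[symmetric]
    using acc_subset[of w] by (intro arg_cong2[where f = "(/)"] sum.cong) auto
  then show ?thesis using local_prob_worlds[OF assms] by simp
qed

text \<open>Complementation turns P(not \<phi>) \<le> c into a lower bound on P(\<phi>). For c = 1/2
  that bound is again 1/2, but attained: dual belief differs from belief only by admitting
  equality.\<close>

lemma sat_B_dual:
  assumes "w \<in> worlds M"
  shows "sat M w (B_dual c \<phi>) \<longleftrightarrow> local_prob M w (ext M \<phi>) \<ge> 1 - of_rat c"
  using local_prob_Neg[OF assms, of \<phi>] by (auto simp: B_dual_def)

section \<open>Validity of the belief principles\<close>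

lemma sat_K_imp_B:
  assumes "w \<in> worlds M" "c < 1" "sat M w (K \<phi>)"
  shows "sat M w (B c \<phi>)"
  using assms by (simp add: sat_K_local_prob del: sat_K)

lemma not_sat_B_Bot: "0 < c \<Longrightarrow> \<not> sat M w (B c Bot)"
  by (simp add: local_prob_def)

lemma sat_B_Top: "w \<in> worlds M \<Longrightarrow> c < 1 \<Longrightarrow> sat M w (B c Top)"
  by (simp add: local_prob_worlds)

text \<open>Local probability depends on \<open>w\<close> only through its class. Positive and
  negative introspection both follow.\<close>

lemma sat_B_acc: "v \<in> acc M `` {w} \<Longrightarrow> sat M v (B c \<phi>) \<longleftrightarrow> sat M w (B c \<phi>)"
  unfolding sat_B by (simp only: local_prob_acc)

lemma sat_B_imp_K_B:
  assumes "w \<in> worlds M" "sat M w (B c \<phi>)"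
  shows "sat M w (K (B c \<phi>))"
  unfolding sat_K[OF assms(1)] using assms sat_B_acc by blast

lemma not_sat_B_imp_K_Neg_B:
  assumes "w \<in> worlds M" "\<not> sat M w (B c \<phi>)"
  shows "sat M w (K (Neg (B c \<phi>)))"
  unfolding sat_K[OF assms(1)] sat.simps using assms sat_B_acc by blast

lemma sat_B_mono:
  assumes "w \<in> worlds M" "sat M w (K (Imp \<phi> \<psi>))" "sat M w (B c \<phi>)"
  shows "sat M w (B c \<psi>)"
proof -
  have "local_prob M w (ext M \<phi>) \<le> local_prob M w (ext M \<psi>)"
    using assms by (intro local_prob_mono) auto
  then show ?thesis using assms by simp
qed

text \<open>For c \<ge> 1/2, a probability above c is above 1 - c.\<close>

lemma sat_B_imp_B_dual:
  assumes "w \<in> worlds M" "1/2 \<le> c" "sat M w (B c \<phi>)"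
  shows "sat M w (B_dual c \<phi>)"
proof -
  have "(of_rat (1/2) :: real) \<le> of_rat c" using assms(2) by (simp only: of_rat_less_eq)
  then show ?thesis using assms by (simp add: sat_B_dual of_rat_divide)
qed

text \<open>The accessible world where \<psi> holds without \<phi> lifts the bound P(\<phi>) \<ge>
  1/2 to a strict one for the disjunction.\<close>

lemma sat_B_half_Disj:
  assumes w: "w \<in> worlds M" and "sat M w (B_dual (1/2) \<phi>)" "sat M w (K_dual (Conj (Neg \<phi>) \<psi>))"
  shows "sat M w (B (1/2) (Disj \<phi> \<psi>))"
proof -
  obtain u where "u \<in> acc M `` {w}" "\<not> sat M u \<phi>" "sat M u \<psi>"
    using assms by (auto simp: K_dual_def)
  then have "local_prob M w (ext M \<phi>) < local_prob M w (ext M (Disj \<phi> \<psi>))"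
    using w acc_subset by (intro local_prob_less[of _ _ _ u]) auto
  then show ?thesis using assms by (simp add: sat_B_dual of_rat_divide)
qed

section \<open>The Segerberg principle\<close>

lemma segerberg_local_prob:
  assumes "w \<in> worlds M" "sat M w (segerberg m \<phi> \<psi>)"
  shows "(\<Sum>i\<in>{1..m}. local_prob M w (ext M (\<phi> i))) \<le> (\<Sum>i\<in>{1..m}. local_prob M w (ext M (\<psi> i)))"
proof (rule local_prob_sum_mono)
  fix v assume v: "v \<in> acc M `` {w}"
  then obtain i where "sat M v (segerberg_disjunct m \<phi> \<psi> i)"
    using assms by (auto simp: segerberg_def)
  then show "card {i \<in> {1..m}. v \<in> ext M (\<phi> i)} \<le> card {i \<in> {1..m}. v \<in> ext M (\<psi> i)}"
    using sat_segerberg_disjunct v acc_subset by fastforce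
qed simp

lemma sat_segerberg_imp_B_half:
  assumes w: "w \<in> worlds M" and "m \<ge> 1" and seg: "sat M w (segerberg m \<phi> \<psi>)"
    and 1: "sat M w (B (1/2) (\<phi> 1))" and 2: "\<And>i. i \<in> {2..m} \<Longrightarrow> sat M w (B_dual (1/2) (\<phi> i))"
  shows "\<exists>i\<in>{1..m}. sat M w (B (1/2) (\<psi> i))"
proof (rule ccontr)
  assume "\<not> ?thesis"
  then have "(\<Sum>i\<in>{1..m}. local_prob M w (ext M (\<psi> i))) \<le> (\<Sum>i\<in>{1..m}. 1/2)"
    by (intro sum_mono) (auto simp: of_rat_divide not_less)
  also have "\<dots> < (\<Sum>i\<in>{1..m}. local_prob M w (ext M (\<phi> i)))"
  proof (rule sum_strict_mono_ex1)
    show "\<forall>i\<in>{1..m}. 1/2 \<le> local_prob M w (ext M (\<phi> i))"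
    proof
      fix i assume "i \<in> {1..m}"
      then consider "i = 1" | "i \<in> {2..m}" by fastforce
      then show "1/2 \<le> local_prob M w (ext M (\<phi> i))"
        using 1 2[of i] w by cases (auto simp: sat_B_dual of_rat_divide)
    qed
    \<comment> \<open>Strictness comes from the belief in \<open>\<phi> 1\<close> alone;
      \<open>m \<ge> 1\<close> puts the index 1 into the range.\<close>
    show "\<exists>i\<in>{1..m}. 1/2 < local_prob M w (ext M (\<phi> i))"
      using 1 \<open>m \<ge> 1\<close> by (auto simp: of_rat_divide intro!: bexI[of _ 1])
  qed simp
  finally show False using segerberg_local_prob[OF w seg] by simp
qed

end

lemma validI:
  assumes "\<And>(M :: ('w, 'p) epm) w. epistemic_model M \<Longrightarrow> w \<in> worlds M \<Longrightarrow> sat M w \<phi>"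
  shows "valid TYPE('w) (\<phi> :: 'p fm)"
  using assms by (auto simp: valid_def epistemic_model_def)

section \<open>Counter-models with a single class\<close>

definition one_class_model :: "'w set \<Rightarrow> ('w \<Rightarrow> 'p set) \<Rightarrow> ('w \<Rightarrow> real) \<Rightarrow> ('w, 'p) epm" where
  "one_class_model W V f =
     \<lparr>worlds = W, acc = W \<times> W, val = V, pr = point_measure W (\<lambda>v. ennreal (f v))\<rparr>"

lemma one_class_model_simps [simp]:
  "worlds (one_class_model W V f) = W" "val (one_class_model W V f) = V"
  by (simp_all add: one_class_model_def)

context
  fixes W :: "'w set" and f :: "'w \<Rightarrow> real"
  assumes W: "finite W" "W \<noteq> {}" and f: "\<And>v. v \<in> W \<Longrightarrow> f v > 0" "sum f W = 1"
begin

lemma measure_one_class_model: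
  assumes "X \<subseteq> W" shows "measure (pr (one_class_model W V f)) X = sum f X"
  using assms W f by (simp add: one_class_model_def measure_point_measure_finite_if less_imp_le)

lemma epistemic_one_class_model: "epistemic_probability_model (one_class_model W V f)"
proof -
  have "prob_space (point_measure W (\<lambda>v. ennreal (f v)))"
    using W f by (intro prob_spaceI)
      (simp add: space_point_measure emeasure_point_measure_finite sum_ennreal less_imp_le)
  moreover have "equiv W (W \<times> W)"
    by (auto simp: equiv_def refl_on_def sym_on_def trans_on_def)
  moreover have "measure (pr (one_class_model W V f)) {v} \<noteq> 0" if "v \<in> W" for v
    using that f(1)[of v] by (simp add: measure_one_class_model)
  ultimately show ?thesis using W
    by (simp add: epistemic_probability_model_def one_class_model_def sets_point_measure)
qed

text \<open>Every world sees all of \<open>W\<close>, whose mass is 1, so conditioning on the class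
  changes nothing.\<close>

lemma local_prob_one_class_model:
  assumes "X \<subseteq> W" "w \<in> W" shows "local_prob (one_class_model W V f) w X = sum f X"
proof -
  have "acc (one_class_model W V f) `` {w} = W"
    using assms by (auto simp: one_class_model_def)
  then show ?thesis using assms f
    by (simp add: local_prob_def measure_one_class_model Int_absorb2)
qed

end

lemma B_distribution_not_valid:
  fixes p q :: 'p
  assumes "0 < c" "c < 1" "p \<noteq> q"
  shows "\<not> valid TYPE(nat)
    (Imp (B c (Imp (Letter p) (Letter q))) (Imp (B c (Letter p)) (B c (Letter q))))"
proof -
  define f where "f v = (if v = 0 then of_rat c else (1 - of_rat c) / 2 :: real)" for v :: nat
  \<comment> \<open>The implication fails only at 1 and \<open>p\<close> only at 2, so each has
    probability (1 + c)/2 > c. But \<open>q\<close> holds only at 0, whose weight is exactly c, and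
    belief demands strictly more.\<close>
  define V where "V v = (if v = 0 then {p, q} else if v = 1 then {p} else {})" for v :: nat
  define M where "M = one_class_model {0, 1, 2} V f"
  have c: "0 < (of_rat c :: real)" "of_rat c < (1 :: real)" using assms by simp_all
  have f: "f v > 0" for v using c by (simp add: f_def)
  have sum: "sum f {0, 1, 2} = 1" by (simp add: f_def)
  have lp: "local_prob M 0 X = sum f X" if "X \<subseteq> {0, 1, 2}" for X
    unfolding M_def using that f sum by (intro local_prob_one_class_model) auto
  have "ext M (Imp (Letter p) (Letter q)) = {0, 2}" "ext M (Letter p) = {0, 1}"
      "ext M (Letter q) = {0}"
    using assms by (auto simp: M_def V_def)
  then have "\<not> sat M 0 (Imp (B c (Imp (Letter p) (Letter q))) (Imp (B c (Letter p)) (B c (Letter q))))"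
    using c by (simp add: lp f_def del: sat.simps)
  moreover have "epistemic_probability_model M"
    unfolding M_def using f sum by (intro epistemic_one_class_model) auto
  ultimately show ?thesis
    unfolding valid_def by (auto simp: M_def intro!: exI[of _ M] bexI[of _ 0])
qed

lemma B_reflection_not_valid:
  fixes p :: 'p
  assumes "0 < c" "c < 1"
  shows "\<not> valid TYPE(nat) (Imp (B c (Letter p)) (Letter p))"
proof -
  \<comment> \<open>World 0 gets the midpoint of c and 1: enough for belief in \<open>p\<close>, yet
    leaving positive mass for world 1, where \<open>p\<close> is false and the instance is
    refuted.\<close>
  define f where "f v = (if v = 0 then (1 + of_rat c) / 2 else (1 - of_rat c) / 2 :: real)" for v :: nat
  define V where "V v = (if v = 0 then {p} else {})" for v :: nat
  define M where "M = one_class_model {0, 1} V f"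
  have c: "0 < (of_rat c :: real)" "of_rat c < (1 :: real)" using assms by simp_all
  have f: "f v > 0" for v using c by (simp add: f_def add_pos_pos)
  have sum: "sum f {0, 1} = 1" by (simp add: f_def field_simps)
  have lp: "local_prob M 1 X = sum f X" if "X \<subseteq> {0, 1}" for X
    unfolding M_def using that f sum by (intro local_prob_one_class_model) auto
  have "ext M (Letter p) = {0}" by (auto simp: M_def V_def)
  then have "sat M 1 (B c (Letter p))" using c lp[of "{0}"] by (simp add: f_def del: sat.simps of_rat_less_1_iff)
  then have "\<not> sat M 1 (Imp (B c (Letter p)) (Letter p))"
    by (simp add: M_def V_def)
  moreover have "epistemic_probability_model M"
    unfolding M_def using f sum by (intro epistemic_one_class_model) auto
  ultimately show ?thesis
    unfolding valid_def by (auto simp: M_def intro!: exI[of _ M] bexI[of _ 1])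
qed

text \<open>Validity is asserted for any type \<open>'w\<close> of worlds, but invalidity for
  \<open>nat\<close>, which has room for the counter-models: over a one-element type,
  \<open>B c \<phi>\<close> and \<open>\<phi>\<close> are equivalent.\<close>

theorem mainTheorem2:
  fixes c :: rat
  assumes "0 < c" and "c < 1"
  shows
    "((\<exists>p q :: 'p. p \<noteq> q) \<longrightarrow>
        \<not> (\<forall>\<phi> \<psi> :: 'p fm. valid TYPE(nat) (Imp (B c (Imp \<phi> \<psi>)) (Imp (B c \<phi>) (B c \<psi>))))) \<and>
     \<not> (\<forall>\<phi> :: 'p fm. valid TYPE(nat) (Imp (B c \<phi>) \<phi>)) \<and>
     (\<forall>\<phi> :: 'p fm. valid TYPE('w) (Imp (K \<phi>) (B c \<phi>))) \<and>
     valid TYPE('w) (Neg (B c Bot) :: 'p fm) \<and>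
     valid TYPE('w) (B c Top :: 'p fm) \<and>
     (\<forall>\<phi> :: 'p fm. valid TYPE('w) (Imp (B c \<phi>) (K (B c \<phi>)))) \<and>
     (\<forall>\<phi> :: 'p fm. valid TYPE('w) (Imp (Neg (B c \<phi>)) (K (Neg (B c \<phi>))))) \<and>
     (\<forall>\<phi> \<psi> :: 'p fm. valid TYPE('w) (Imp (K (Imp \<phi> \<psi>)) (Imp (B c \<phi>) (B c \<psi>)))) \<and>
     (1/2 \<le> c \<longrightarrow> (\<forall>\<phi> :: 'p fm. valid TYPE('w) (Imp (B c \<phi>) (B_dual c \<phi>)))) \<and>
     (\<forall>\<phi> \<psi> :: 'p fm. valid TYPE('w)
        (Imp (Conj (B_dual (1/2) \<phi>) (K_dual (Conj (Neg \<phi>) \<psi>))) (B (1/2) (Disj \<phi> \<psi>)))) \<and>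
     (\<forall>m \<ge> 1. \<forall>\<phi> \<psi> :: nat \<Rightarrow> 'p fm. valid TYPE('w)
        (Imp (Conjs [segerberg m \<phi> \<psi>, B (1/2) (\<phi> 1),
                     Conjs (map (\<lambda>i. B_dual (1/2) (\<phi> i)) [2..<Suc m])])
             (Disjs (map (\<lambda>i. B (1/2) (\<psi> i)) [1..<Suc m]))))"
proof (intro conjI impI allI)
  assume "\<exists>p q :: 'p. p \<noteq> q"
  then obtain p q :: 'p where "p \<noteq> q" by blast
  show "\<not> (\<forall>\<phi> \<psi> :: 'p fm. valid TYPE(nat) (Imp (B c (Imp \<phi> \<psi>)) (Imp (B c \<phi>) (B c \<psi>))))"
  proof
    assume all: "\<forall>\<phi> \<psi> :: 'p fm. valid TYPE(nat) (Imp (B c (Imp \<phi> \<psi>)) (Imp (B c \<phi>) (B c \<psi>)))"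
    show False
      by (rule notE[OF B_distribution_not_valid[OF assms \<open>p \<noteq> q\<close>] all[rule_format]])
  qed
next
  show "\<not> (\<forall>\<phi> :: 'p fm. valid TYPE(nat) (Imp (B c \<phi>) \<phi>))"
  proof
    assume all: "\<forall>\<phi> :: 'p fm. valid TYPE(nat) (Imp (B c \<phi>) \<phi>)"
    show False by (rule notE[OF B_reflection_not_valid[OF assms] all[rule_format]])
  qed
next
  fix \<phi> :: "'p fm"
  show "valid TYPE('w) (Imp (K \<phi>) (B c \<phi>))"
    by (rule validI, unfold sat_Imp, intro impI, rule epistemic_model.sat_K_imp_B[OF _ _ assms(2)])
next
  show "valid TYPE('w) (Neg (B c Bot) :: 'p fm)"
    by (rule validI, unfold sat.simps, rule epistemic_model.not_sat_B_Bot[OF _ assms(1)])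
next
  show "valid TYPE('w) (B c Top :: 'p fm)"
    by (rule validI, rule epistemic_model.sat_B_Top[OF _ _ assms(2)])
next
  fix \<phi> :: "'p fm"
  show "valid TYPE('w) (Imp (B c \<phi>) (K (B c \<phi>)))"
    by (rule validI, unfold sat_Imp, intro impI, rule epistemic_model.sat_B_imp_K_B)
next
  fix \<phi> :: "'p fm"
  show "valid TYPE('w) (Imp (Neg (B c \<phi>)) (K (Neg (B c \<phi>))))"
    by (rule validI, unfold sat_Imp sat.simps(3), intro impI,
        rule epistemic_model.not_sat_B_imp_K_Neg_B)
next
  fix \<phi> \<psi> :: "'p fm"
  show "valid TYPE('w) (Imp (K (Imp \<phi> \<psi>)) (Imp (B c \<phi>) (B c \<psi>)))"
    by (rule validI, subst sat_Imp, rule impI, subst sat_Imp, rule impI,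
        rule epistemic_model.sat_B_mono)
next
  fix \<phi> :: "'p fm"
  assume "1/2 \<le> c"
  then show "valid TYPE('w) (Imp (B c \<phi>) (B_dual c \<phi>))"
    by (intro validI, unfold sat_Imp, intro impI, intro epistemic_model.sat_B_imp_B_dual)
next
  fix \<phi> \<psi> :: "'p fm"
  show "valid TYPE('w)
      (Imp (Conj (B_dual (1/2) \<phi>) (K_dual (Conj (Neg \<phi>) \<psi>))) (B (1/2) (Disj \<phi> \<psi>)))"
    by (rule validI, unfold sat_Imp sat.simps(4), intro impI, elim conjE,
        rule epistemic_model.sat_B_half_Disj)
next
  fix m :: nat and \<phi> \<psi> :: "nat \<Rightarrow> 'p fm"
  assume m: "m \<ge> 1"
  show "valid TYPE('w)
      (Imp (Conjs [segerberg m \<phi> \<psi>, B (1/2) (\<phi> 1),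
                   Conjs (map (\<lambda>i. B_dual (1/2) (\<phi> i)) [2..<Suc m])])
           (Disjs (map (\<lambda>i. B (1/2) (\<psi> i)) [1..<Suc m])))"
  proof (rule validI)
    fix M :: "('w, 'p) epm" and w
    assume "epistemic_model M" "w \<in> worlds M"
    then show "sat M w (Imp (Conjs [segerberg m \<phi> \<psi>, B (1/2) (\<phi> 1),
                   Conjs (map (\<lambda>i. B_dual (1/2) (\<phi> i)) [2..<Suc m])])
           (Disjs (map (\<lambda>i. B (1/2) (\<psi> i)) [1..<Suc m])))"
      \<comment> \<open>For m = 1 the list \<open>[2..<Suc m]\<close> is empty and its conjunction
        is \<open>Top\<close>.\<close>
      using epistemic_model.sat_segerberg_imp_B_half[OF _ _ m, of M w \<phi> \<psi>]
      by (simp del: sat_B upt_Suc add: atLeastLessThanSuc_atLeastAtMost)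
  qed
qed

end
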